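(* Let $d\geq1$ be an integer and let $A\subseteq\mathbb{R}^d$ be a measurable set. Then the limit below exists and $$\overline{\delta}(A)=\lim_{R\to\infty}\ \sup_{z\in\mathbb{R}^d}\frac{|A\cap(z+[0,R]^d)|}{R^d}.$$
   Context: $|\cdot|$ of a set denotes Lebesgue measure. The upper Banach density of a measurable $A\subseteq\mathbb{R}^d$ is defined as $\overline{\delta}(A):=\limsup_{R\to\infty}\sup_{z\in\mathbb{R}^d}\frac{|A\cap(z+[0,R]^d)|}{R^d}$. *)

theory Defs
  imports "HOL-Analysis.Analysis"
begin

(* The cube z + [0,R]^d is bounded, so the real-valued measure is the true
   Lebesgue measure of the intersection whenever A is Lebesgue measurable. *)
definition cube_density :: "(real ^ 'n) set \<Rightarrow> real \<Rightarrow> real ^ 'n \<Rightarrow> real" where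
  "cube_density A R z =
     measure lebesgue (A \<inter> (+) z ` cbox 0 (vec R)) / R ^ CARD('n)"

(* Supremum and limit superior are taken in the complete lattice of extended reals. *)
definition upper_Banach_density :: "(real ^ 'n) set \<Rightarrow> ereal" where
  "upper_Banach_density A =
     Limsup at_top (\<lambda>R::real. SUP z. ereal (cube_density A R z))"

end

theory Submission
  imports Defs "HOL-Real_Asymp.Real_Asymp"
begin

text \<open>
  Let \<open>F R\<close> be the supremum over all cubes of side \<open>R\<close> of the density of \<open>A\<close>.  For fixed \<open>S > 0\<close>
  a cube of side \<open>R\<close> is covered by \<open>\<lceil>R / S\<rceil>\<^sup>d\<close> cubes of side \<open>S\<close>, hence
  \<open>F R \<le> ((R + S) / R)\<^sup>d * F S\<close>.  Letting \<open>R\<close> tend to infinity shows that \<open>F\<close> converges to its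
  infimum.
\<close>

lemma translate_cube_eq:
  fixes z :: "real ^ 'n"
  shows "(+) z ` cbox 0 (vec R) = cbox z (z + vec R)"
  using cbox_translation[of z 0 "vec R"] by simp

text \<open>Each coordinate is treated on its own: dividing the offset from \<open>z\<close> by
  \<open>S\<close> and rounding down picks the grid index. Neighbouring closed cubes share faces,
  which is harmless because only an upper bound on measure is drawn from the covering.\<close>

lemma translate_cube_subset_grid:
  fixes z :: "real ^ 'n"
  assumes "S > 0" and "R \<le> real k * S" and "k > 0"
  shows "(+) z ` cbox 0 (vec R) \<subseteq>
    (\<Union>j \<in> PiE UNIV (\<lambda>_::'n. {..<k}). (+) (z + (\<chi> i. S * real (j i))) ` cbox 0 (vec S))"
proof
  fix x assume "x \<in> (+) z ` cbox 0 (vec R)"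
  then have x: "z $ i \<le> x $ i" "x $ i - z $ i \<le> R" for i
    by (auto simp: translate_cube_eq mem_box_cart algebra_simps)
  \<comment> \<open>The \<open>min\<close> matters when \<open>x\<close> lies on the far face: there the floor alone may give the index \<open>k\<close>.\<close>
  define j where "j i = min (nat \<lfloor>(x $ i - z $ i) / S\<rfloor>) (k - 1)" for i
  have j: "j i < k" "S * real (j i) \<le> x $ i - z $ i" "x $ i - z $ i \<le> S * real (j i) + S" for i
  proof -
    define t where "t = (x $ i - z $ i) / S"
    have t: "0 \<le> t" "t \<le> real k" "x $ i - z $ i = S * t"
      using x[of i] assms by (auto simp: t_def field_simps)
    have ji: "j i = min (nat \<lfloor>t\<rfloor>) (k - 1)" by (simp add: j_def t_def)
    show "j i < k" using assms by (simp add: j_def)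
    have "real (j i) \<le> t" "t \<le> real (j i) + 1"
      using t assms(3) unfolding ji by (auto simp: min_def of_nat_diff) linarith+
    then show "S * real (j i) \<le> x $ i - z $ i" "x $ i - z $ i \<le> S * real (j i) + S"
      using assms(1) mult_left_mono[of "t" "real (j i) + 1" S] by (auto simp: t(3) distrib_left)
  qed
  have "j \<in> PiE UNIV (\<lambda>_. {..<k})"
      "x \<in> (+) (z + (\<chi> i. S * real (j i))) ` cbox 0 (vec S)"
    unfolding translate_cube_eq using j by (auto simp: mem_box_cart algebra_simps)
  then show "x \<in> (\<Union>j \<in> PiE UNIV (\<lambda>_::'n. {..<k}).
      (+) (z + (\<chi> i. S * real (j i))) ` cbox 0 (vec S))"
    by blast
qed

lemma lmeasurable_Int_cube:
  fixes A :: "(real ^ 'n) set"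
  assumes "A \<in> sets lebesgue"
  shows "A \<inter> (+) z ` cbox 0 (vec R) \<in> lmeasurable"
  unfolding translate_cube_eq
  using assms by (metis inf_commute fmeasurable_Int_fmeasurable lmeasurable_cbox)

text \<open>Finite subadditivity over the \<open>k ^ CARD('n)\<close> grid cubes. The bound
  \<open>M\<close> is uniform in the translation, so it applies to every grid cube wherever
  \<open>z\<close> lies.\<close>

lemma measure_Int_cube_le_grid:
  fixes A :: "(real ^ 'n) set"
  assumes A: "A \<in> sets lebesgue"
    and "S > 0" "R \<le> real k * S" "k > 0"
    and M: "\<And>z. measure lebesgue (A \<inter> (+) z ` cbox 0 (vec S)) \<le> M"
  shows "measure lebesgue (A \<inter> (+) z ` cbox 0 (vec R)) \<le> real k ^ CARD('n) * M"
proof -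
  let ?J = "PiE UNIV (\<lambda>_::'n. {..<k})"
  let ?Q = "\<lambda>j. A \<inter> (+) (z + (\<chi> i. S * real (j i))) ` cbox 0 (vec S)"
  have fin: "finite ?J" by (intro finite_PiE) auto
  have "measure lebesgue (A \<inter> (+) z ` cbox 0 (vec R)) \<le> measure lebesgue (\<Union>j\<in>?J. ?Q j)"
  proof (rule measure_mono_fmeasurable)
    show "A \<inter> (+) z ` cbox 0 (vec R) \<subseteq> (\<Union>j\<in>?J. ?Q j)"
      using translate_cube_subset_grid[OF assms(2-4), of z] by blast
    show "A \<inter> (+) z ` cbox 0 (vec R) \<in> sets lebesgue"
      using lmeasurable_Int_cube[OF A] by (rule fmeasurableD)
    show "(\<Union>j\<in>?J. ?Q j) \<in> lmeasurable"
      by (intro fmeasurable.finite_UN fin lmeasurable_Int_cube[OF A])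
  qed
  also have "\<dots> \<le> (\<Sum>j\<in>?J. measure lebesgue (?Q j))"
    by (intro measure_UNION_le fin fmeasurableD lmeasurable_Int_cube[OF A])
  also have "\<dots> \<le> of_nat (card ?J) * M"
    by (intro sum_bounded_above M)
  also have "card ?J = k ^ CARD('n)"
    by (simp add: card_PiE)
  finally show ?thesis by simp
qed

lemma cube_density_nonneg: "R > 0 \<Longrightarrow> 0 \<le> cube_density A R z"
  by (simp add: cube_density_def)

lemma cube_density_le_1:
  fixes A :: "(real ^ 'n) set"
  assumes "A \<in> sets lebesgue" "R > 0"
  shows "cube_density A R z \<le> 1"
proof -
  have "measure lebesgue (A \<inter> (+) z ` cbox 0 (vec R)) \<le> measure lebesgue (cbox z (z + vec R))"
    using lmeasurable_Int_cube[OF assms(1), of z R]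
    by (intro measure_mono_fmeasurable) (auto simp: translate_cube_eq)
  also have "\<dots> = R ^ CARD('n)"
    using assms(2) by (simp add: content_cbox_cart interval_ne_empty_cart)
  finally show ?thesis
    using assms(2) by (simp add: cube_density_def)
qed

text \<open>A real-valued supremum, so that products and limits can be handled by real arithmetic.
  For measurable \<open>A\<close> and \<open>R > 0\<close> the densities lie between 0 and 1, so it
  is a genuine least upper bound.\<close>

definition sup_cube_density :: "(real ^ 'n) set \<Rightarrow> real \<Rightarrow> real" where
  "sup_cube_density A R = (SUP z. cube_density A R z)"

lemma cube_density_le_sup:
  assumes "A \<in> sets lebesgue" "R > 0"
  shows "cube_density A R z \<le> sup_cube_density A R"
  unfolding sup_cube_density_def
  by (rule cSUP_upper) (auto intro!: bdd_aboveI2 cube_density_le_1[OF assms])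

lemma sup_cube_density_nonneg:
  assumes "A \<in> sets lebesgue" "R > 0"
  shows "0 \<le> sup_cube_density A R"
  using cube_density_nonneg[OF assms(2)] cube_density_le_sup[OF assms] order_trans by blast

lemma SUP_ereal_cube_density:
  assumes "A \<in> sets lebesgue" "R > 0"
  shows "(SUP z. ereal (cube_density A R z)) = ereal (sup_cube_density A R)"
proof (rule antisym)
  show "(SUP z. ereal (cube_density A R z)) \<le> ereal (sup_cube_density A R)"
    by (rule SUP_least) (simp add: cube_density_le_sup[OF assms])
  have "0 \<le> (SUP z. ereal (cube_density A R z))"
    by (rule SUP_upper2[of 0]) (simp_all add: cube_density_nonneg assms)
  moreover have "(SUP z. ereal (cube_density A R z)) \<le> 1"
    by (rule SUP_least) (simp add: cube_density_le_1[OF assms])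
  \<comment> \<open>Finiteness is what lets \<open>ereal_SUP\<close> move the embedding of the reals
    past the supremum.\<close>
  ultimately have "\<bar>SUP z. ereal (cube_density A R z)\<bar> \<noteq> \<infinity>"
    by auto
  then show "ereal (sup_cube_density A R) \<le> (SUP z. ereal (cube_density A R z))"
    by (simp add: sup_cube_density_def ereal_SUP)
qed

lemma sup_cube_density_le:
  fixes A :: "(real ^ 'n) set"
  assumes A: "A \<in> sets lebesgue" and "R > 0" "S > 0"
  shows "sup_cube_density A R \<le> ((R + S) / R) ^ CARD('n) * sup_cube_density A S"
  unfolding sup_cube_density_def[of A R]
proof (rule cSUP_least)
  fix z :: "real ^ 'n"
  \<comment> \<open>The number of cubes of side \<open>S\<close> along one edge. Rounding up adds at
    most one, so the grid has side at most \<open>R + S\<close>; this is the source of the factor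
    \<open>(R + S) / R\<close>.\<close>
  define k where "k = nat \<lceil>R / S\<rceil>"
  have k: "k > 0" "R / S \<le> real k" "real k \<le> R / S + 1"
    using assms by (auto simp: k_def)
  then have kS: "R \<le> real k * S" "real k * S \<le> R + S"
    using assms by (auto simp: field_simps)
  \<comment> \<open>The uniform bound for one grid cube is its volume times the supremal density at
    scale \<open>S\<close>.\<close>
  have "measure lebesgue (A \<inter> (+) z ` cbox 0 (vec R))
      \<le> real k ^ CARD('n) * (S ^ CARD('n) * sup_cube_density A S)"
    using cube_density_le_sup[OF A \<open>S > 0\<close>] \<open>S > 0\<close>
    by (intro measure_Int_cube_le_grid[OF A \<open>S > 0\<close> kS(1) k(1)])
      (simp add: cube_density_def field_simps)
  also have "\<dots> = (real k * S) ^ CARD('n) * sup_cube_density A S"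
    by (simp add: power_mult_distrib)
  also have "\<dots> \<le> (R + S) ^ CARD('n) * sup_cube_density A S"
    using kS assms by (intro mult_right_mono power_mono sup_cube_density_nonneg) auto
  finally show "cube_density A R z \<le> ((R + S) / R) ^ CARD('n) * sup_cube_density A S"
    using \<open>R > 0\<close> by (simp add: cube_density_def power_divide divide_right_mono)
qed simp

lemma sup_cube_density_tendsto_Inf:
  fixes A :: "(real ^ 'n) set"
  assumes A: "A \<in> sets lebesgue"
  shows "(sup_cube_density A \<longlongrightarrow> (INF S\<in>{0<..}. sup_cube_density A S)) at_top"
proof (rule order_tendstoI)
  let ?L = "INF S\<in>{0<..}. sup_cube_density A S"
  have bdd: "bdd_below (sup_cube_density A ` {0<..})"
    by (rule bdd_belowI2[of _ 0]) (simp add: sup_cube_density_nonneg[OF A])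
  \<comment> \<open>The easy half: every value at a positive scale is at least the infimum.\<close>
  show "\<forall>\<^sub>F R in at_top. a < sup_cube_density A R" if "a < ?L" for a
    using eventually_gt_at_top[of 0]
    by eventually_elim (use that cINF_lower[OF bdd] in \<open>force intro: less_le_trans\<close>)
  show "\<forall>\<^sub>F R in at_top. sup_cube_density A R < a" if "?L < a" for a
  proof -
    \<comment> \<open>The scale \<open>S\<close> nearly attains the infimum and stays fixed while
      \<open>R\<close> grows, so the covering factor tends to 1 and the bound falls below
      \<open>a\<close>.\<close>
    obtain S where S: "S > 0" "sup_cube_density A S < a"
      using \<open>?L < a\<close> cINF_less_iff[OF _ bdd, of a] by auto
    have "((\<lambda>R. (R + S) / R) \<longlongrightarrow> 1) at_top"
      by real_asymp
    then have "((\<lambda>R. ((R + S) / R) ^ CARD('n) * sup_cube_density A S)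
        \<longlongrightarrow> 1 ^ CARD('n) * sup_cube_density A S) at_top"
      by (intro tendsto_intros)
    then have "\<forall>\<^sub>F R in at_top. ((R + S) / R) ^ CARD('n) * sup_cube_density A S < a"
      by (rule order_tendstoD) (use S in simp)
    then show ?thesis
      using eventually_gt_at_top[of 0]
      by eventually_elim (use sup_cube_density_le[OF A _ S(1)] in \<open>force intro: le_less_trans\<close>)
  qed
qed

theorem propositionA3:
  fixes A :: "(real ^ 'n) set"
  assumes "A \<in> sets lebesgue"
  shows "\<exists>L::real. ((\<lambda>R::real. SUP z. ereal (cube_density A R z)) \<longlongrightarrow> ereal L) at_top
           \<and> upper_Banach_density A = ereal L"
proof (intro exI conjI)
  let ?L = "INF S\<in>{0<..}. sup_cube_density A S"
  have "((\<lambda>R. ereal (sup_cube_density A R)) \<longlongrightarrow> ereal ?L) at_top"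
    by (intro tendsto_intros sup_cube_density_tendsto_Inf assms)
  \<comment> \<open>The real and extended suprema are identified only for \<open>R > 0\<close>,
    which suffices for a limit at infinity.\<close>
  moreover have "\<forall>\<^sub>F R in at_top.
      ereal (sup_cube_density A R) = (SUP z. ereal (cube_density A R z))"
    using eventually_gt_at_top[of 0] by eventually_elim (simp add: SUP_ereal_cube_density assms)
  ultimately show lim: "((\<lambda>R::real. SUP z. ereal (cube_density A R z)) \<longlongrightarrow> ereal ?L) at_top"
    by (rule Lim_transform_eventually)
  show "upper_Banach_density A = ereal ?L"
    unfolding upper_Banach_density_def by (rule lim_imp_Limsup[OF _ lim]) simp
qed

end
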